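(* Let $r,n\ge 1$ be integers. Then $$\sum_{\pi\in G(r,n)}t^{\mathrm{rmaj}(\pi)}q^{\mathrm{fmaj}(\pi)} =\prod_{k=1}^{n}[r]_{t^kq}\,[k]_{tq^r}.$$
   Context: For an integer $m\ge 0$ and any quantity $p$, $[m]_p:=1+p+\cdots+p^{m-1}$. $G(r,n)=C_r\wr\mathfrak S_n$ is the group of $r$-colored permutations; an element is a word $\pi=\pi_1\cdots\pi_n=\sigma_1^{[z_1]}\cdots\sigma_n^{[z_n]}$ with $\sigma\in\mathfrak S_n$ and colors $z_i\in\{0,1,\dots,r-1\}$, with $i^{[0]}=i$. The colored letters are ordered linearly by $$(1^{[r-1]}<\cdots<n^{[r-1]})<\cdots<(1^{[1]}<\cdots<n^{[1]})<(1<\cdots<n),$$ and with respect to this order $\mathrm{maj}(\pi):=\sum_{1\le i\le n-1,\ \pi_i>\pi_{i+1}} i$. The flag major index is $\mathrm{fmaj}(\pi):=r\cdot\mathrm{maj}(\pi)+\sum_{i=1}^n z_i$, and the root major index is $\mathrm{rmaj}(\pi):=\mathrm{maj}(\pi)+\sum_{i=1}^n z_i\sigma_i$. *)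

theory Defs
  imports "HOL-Combinatorics.Permutations" "HOL-Library.FuncSet"
begin

definition bracket :: "nat \<Rightarrow> 'a::comm_ring_1 \<Rightarrow> 'a" where
  "bracket m p = (\<Sum>i<m. p ^ i)"

text \<open>
  The pair \<open>(\<sigma>, z)\<close> encodes the word whose \<open>i\<close>-th letter, for \<open>1 \<le> i \<le> n\<close>, is \<open>\<sigma> i\<close>
  with color \<open>z i\<close>. The color function is extensional, that is, it has a fixed
  irrelevant value outside \<open>{1..n}\<close>, so each word is encoded exactly once.
\<close>

type_synonym colored_word = "(nat \<Rightarrow> nat) \<times> (nat \<Rightarrow> nat)"

definition colored_perms :: "nat \<Rightarrow> nat \<Rightarrow> colored_word set" where
  "colored_perms r n = {\<sigma>. \<sigma> permutes {1..n}} \<times> ({1..n} \<rightarrow>\<^sub>E {0..<r})"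

definition letter :: "colored_word \<Rightarrow> nat \<Rightarrow> nat \<times> nat" where
  "letter \<pi> i = (fst \<pi> i, snd \<pi> i)"

text \<open>
  The linear order on colored letters \<open>(value, color)\<close>: a larger color makes a letter
  smaller, and letters of equal color are compared by their values.
\<close>

definition letter_less :: "nat \<times> nat \<Rightarrow> nat \<times> nat \<Rightarrow> bool" where
  "letter_less x y \<longleftrightarrow> snd y < snd x \<or> (snd x = snd y \<and> fst x < fst y)"

definition maj :: "nat \<Rightarrow> colored_word \<Rightarrow> nat" where
  "maj n \<pi> = (\<Sum>i | 1 \<le> i \<and> i \<le> n - 1 \<and> letter_less (letter \<pi> (i + 1)) (letter \<pi> i). i)"

definition fmaj :: "nat \<Rightarrow> nat \<Rightarrow> colored_word \<Rightarrow> nat" where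
  "fmaj r n \<pi> = r * maj n \<pi> + (\<Sum>i=1..n. snd \<pi> i)"

definition rmaj :: "nat \<Rightarrow> colored_word \<Rightarrow> nat" where
  "rmaj n \<pi> = maj n \<pi> + (\<Sum>i=1..n. snd \<pi> i * fst \<pi> i)"

end

theory Submission
  imports Defs "HOL-Combinatorics.Multiset_Permutations" "HOL-Library.Product_Lexorder"
begin

text \<open>
  Attach the colors to values instead of positions: write \<open>z i = c (\<sigma> i)\<close>, so that \<open>c j\<close> is the
  color of the letter with value \<open>j\<close>. Then \<open>\<Sum>\<^sub>i z\<^sub>i = \<Sum>\<^sub>j c\<^sub>j\<close> and \<open>\<Sum>\<^sub>i z\<^sub>i \<sigma>\<^sub>i = \<Sum>\<^sub>j j c\<^sub>j\<close> no longer depend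
  on \<open>\<sigma>\<close>, and the weight of a word becomes
  \<open>(t q\<^sup>r) ^ maj(\<pi>) * (\<Prod>\<^sub>j (t\<^sup>j q) ^ c\<^sub>j)\<close>.

  For a fixed \<open>c\<close>, the words with these colors are exactly the arrangements of \<open>n\<close> distinct letters
  from a linearly ordered alphabet. MacMahon's theorem says that \<open>p ^ maj\<close>, summed over the
  arrangements of \<open>n\<close> distinct letters, gives \<open>[1]\<^sub>p \<cdots> [n]\<^sub>p\<close>, whatever the letters are
  (\<open>sum_rev_maj_permutations_of_set\<close>). So the sum over \<open>\<sigma>\<close> is a constant factor, and the remaining
  sum over \<open>c\<close> factors over the values \<open>j\<close>, each of which contributes \<open>[r]\<close> at \<open>t\<^sup>j q\<close>.

  MacMahon's theorem is proved by refining it according to the last letter \<open>a\<close>: if \<open>k\<close> of the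
  letters exceed \<open>a\<close>, then the arrangements that end in \<open>a\<close> contribute \<open>p\<^sup>k [1]\<^sub>p \<cdots> [n-1]\<^sub>p\<close>
  (\<open>sum_rev_maj_Cons\<close>). This follows by induction on \<open>n\<close>, removing the last letter.
\<close>

section \<open>Ranks in a finite linearly ordered set\<close>

definition num_above :: "'a::linorder set \<Rightarrow> 'a \<Rightarrow> nat" where
  "num_above B a = card {c \<in> B. a < c}"

lemma num_above_le_card: "finite B \<Longrightarrow> num_above B a \<le> card B"
  unfolding num_above_def by (rule card_mono) auto

lemma num_above_strict_antimono:
  assumes "finite B" "b \<in> B" "a < b"
  shows "num_above B b < num_above B a"
  unfolding num_above_def using assms by (intro psubset_card_mono) auto

lemma num_above_antimono:
  assumes "finite B" "a \<le> b"
  shows "num_above B b \<le> num_above B a"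
  unfolding num_above_def using assms by (intro card_mono) auto

lemma bij_betw_num_above:
  assumes "finite B"
  shows "bij_betw (num_above B) B {..<card B}"
proof -
  have inj: "inj_on (num_above B) B"
  proof (rule inj_onI)
    fix a b assume ab: "a \<in> B" "b \<in> B" "num_above B a = num_above B b"
    show "a = b"
      using num_above_strict_antimono[OF assms ab(1), of b]
        num_above_strict_antimono[OF assms ab(2), of a] ab(3)
      by (cases a b rule: linorder_cases) auto
  qed
  have "num_above B a < card B" if "a \<in> B" for a
    unfolding num_above_def using that assms by (intro psubset_card_mono) auto
  then have "num_above B ` B = {..<card B}"
    using inj by (intro card_subset_eq) (auto simp: card_image)
  with inj show ?thesis by (simp add: bij_betw_def)
qed

lemma sum_power_num_above:
  fixes p :: "'b::comm_ring_1"
  assumes "finite B"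
  shows "(\<Sum>b\<in>B. p ^ num_above B b) = bracket (card B) p"
  unfolding bracket_def by (rule sum.reindex_bij_betw[OF bij_betw_num_above[OF assms]])

text \<open>
  With \<open>N = card B\<close> and \<open>k = num_above B a\<close>, the elements above \<open>a\<close> are those of rank less than \<open>k\<close>.
  The factor \<open>p\<^sup>N\<close> moves their exponents \<open>0, \<dots>, k - 1\<close> to \<open>N, \<dots>, N + k - 1\<close>, so that the exponents
  fill the interval from \<open>k\<close> to \<open>N + k - 1\<close>.
\<close>

lemma sum_power_num_above_rotated:
  fixes p :: "'b::comm_ring_1"
  assumes "finite B" "a \<notin> B"
  shows "(\<Sum>b\<in>B. (if a < b then p ^ card B else 1) * p ^ num_above B b) =
         p ^ num_above B a * bracket (card B) p"
proof -
  let ?N = "card B" and ?k = "num_above B a"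
  have above_iff: "a < b \<longleftrightarrow> num_above B b < ?k" if "b \<in> B" for b
  proof (cases "a < b")
    case True
    then show ?thesis using num_above_strict_antimono[OF assms(1) that] by simp
  next
    case False
    then have "?k \<le> num_above B b" using num_above_antimono[OF assms(1), of b a] by simp
    with False show ?thesis by simp
  qed
  have k_le: "?k \<le> ?N" by (rule num_above_le_card[OF assms(1)])
  have "(\<Sum>b\<in>B. (if a < b then p ^ ?N else 1) * p ^ num_above B b) =
        (\<Sum>b\<in>B. (\<lambda>i. (if i < ?k then p ^ ?N else 1) * p ^ i) (num_above B b))"
    by (rule sum.cong) (auto simp: above_iff)
  also have "\<dots> = (\<Sum>i<?N. (if i < ?k then p ^ ?N else 1) * p ^ i)"
    by (rule sum.reindex_bij_betw[OF bij_betw_num_above[OF assms(1)]])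
  also have "\<dots> = (\<Sum>i=0..<?k. (if i < ?k then p ^ ?N else 1) * p ^ i) +
                  (\<Sum>i=?k..<?N. (if i < ?k then p ^ ?N else 1) * p ^ i)"
    unfolding lessThan_atLeast0
    by (rule sum.atLeastLessThan_concat[symmetric]) (use k_le in auto)
  also have "\<dots> = (\<Sum>i=0..<?k. p ^ (i + ?N)) + (\<Sum>i=?k..<?N. p ^ i)"
    by (intro arg_cong2[where f = plus] sum.cong) (auto simp: power_add mult.commute)
  also have "(\<Sum>i=0..<?k. p ^ (i + ?N)) = (\<Sum>i=?N..<?k + ?N. p ^ i)"
    using sum.shift_bounds_nat_ivl[of "\<lambda>i. p ^ i" 0 ?N ?k] by simp
  also have "\<dots> + (\<Sum>i=?k..<?N. p ^ i) = (\<Sum>i=?k..<?k + ?N. p ^ i)"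
    using sum.atLeastLessThan_concat[of ?k ?N "?k + ?N" "\<lambda>i. p ^ i"] k_le
    by (simp add: add.commute)
  also have "\<dots> = (\<Sum>i<?N. p ^ (i + ?k))"
    using sum.shift_bounds_nat_ivl[of "\<lambda>i. p ^ i" 0 ?k ?N]
    by (simp add: add.commute lessThan_atLeast0)
  also have "\<dots> = p ^ ?k * bracket ?N p"
    by (simp add: bracket_def sum_distrib_left power_add mult.commute)
  finally show ?thesis .
qed

section \<open>MacMahon's theorem\<close>

text \<open>
  The major index of the reversed word \<open>rev xs\<close>. Words are stored in reverse because the recursion
  removes the last letter, and because the descent created by the last letter then has the length
  of the remaining list as its position.
\<close>

fun rev_maj :: "'a::linorder list \<Rightarrow> nat" where
  "rev_maj [] = 0"
| "rev_maj [x] = 0"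
| "rev_maj (x # y # ys) = (if x < y then length (y # ys) else 0) + rev_maj (y # ys)"

lemma sum_permutations_of_set_Cons:
  assumes "finite A" "A \<noteq> {}"
  shows "(\<Sum>xs\<in>permutations_of_set A. g xs) =
         (\<Sum>a\<in>A. \<Sum>ys\<in>permutations_of_set (A - {a}). g (a # ys))"
proof -
  have "(\<Sum>xs\<in>permutations_of_set A. g xs) =
        (\<Sum>a\<in>A. \<Sum>xs\<in>(#) a ` permutations_of_set (A - {a}). g xs)"
    unfolding permutations_of_set_nonempty[OF assms(2)]
    by (rule sum.UNION_disjoint) (use assms in auto)
  then show ?thesis by (simp add: sum.reindex)
qed

text \<open>
  Removing the last letter \<open>a\<close> leaves an arrangement of \<open>B = A - {a}\<close> that ends in some \<open>b\<close>, and
  \<open>a\<close> adds a descent at position \<open>card B\<close> exactly if \<open>a < b\<close>. Summing the induction hypothesis over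
  \<open>b\<close> is therefore the sum in \<open>sum_power_num_above_rotated\<close>.
\<close>

lemma sum_rev_maj_Cons:
  fixes p :: "'b::comm_ring_1"
  assumes "finite A" "a \<in> A"
  shows "(\<Sum>ys\<in>permutations_of_set (A - {a}). p ^ rev_maj (a # ys)) =
         p ^ num_above A a * (\<Prod>k=1..<card A. bracket k p)"
  using assms
proof (induction "card A" arbitrary: A a rule: less_induct)
  case less
  define B where "B = A - {a}"
  have fin: "finite B" and a_notin: "a \<notin> B" using less.prems by (auto simp: B_def)
  have card_A: "card A = Suc (card B)"
    using less.prems unfolding B_def by (metis card.remove)
  have above_A: "num_above A a = num_above B a"
    unfolding num_above_def B_def by (rule arg_cong[where f = card]) auto
  show ?case
  proof (cases "B = {}")
    case True
    then have "A = {a}" using less.prems by (auto simp: B_def)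
    then have "{c \<in> A. a < c} = {}" by auto
    then have "num_above A a = 0" by (simp only: num_above_def card.empty)
    with \<open>A = {a}\<close> show ?thesis by simp
  next
    case False
    have step: "(\<Sum>zs\<in>permutations_of_set (B - {b}). p ^ rev_maj (a # b # zs)) =
        (if a < b then p ^ card B else 1) * p ^ num_above B b * (\<Prod>k=1..<card B. bracket k p)"
      if "b \<in> B" for b
    proof -
      have "length (b # zs) = card B" if "zs \<in> permutations_of_set (B - {b})" for zs
        using length_finite_permutations_of_set[OF that] \<open>b \<in> B\<close> fin
        by (metis card.remove length_Cons)
      then have "(\<Sum>zs\<in>permutations_of_set (B - {b}). p ^ rev_maj (a # b # zs)) =
          (\<Sum>zs\<in>permutations_of_set (B - {b}).
             (if a < b then p ^ card B else 1) * p ^ rev_maj (b # zs))"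
        by (intro sum.cong) (auto simp: power_add)
      also have "\<dots> = (if a < b then p ^ card B else 1) *
          (\<Sum>zs\<in>permutations_of_set (B - {b}). p ^ rev_maj (b # zs))"
        by (rule sum_distrib_left[symmetric])
      also have "(\<Sum>zs\<in>permutations_of_set (B - {b}). p ^ rev_maj (b # zs)) =
          p ^ num_above B b * (\<Prod>k=1..<card B. bracket k p)"
        using less.hyps[of B b] card_A fin that by simp
      finally show ?thesis by (simp add: mult.assoc)
    qed
    have "(\<Sum>ys\<in>permutations_of_set B. p ^ rev_maj (a # ys)) =
        (\<Sum>b\<in>B. (if a < b then p ^ card B else 1) * p ^ num_above B b *
                (\<Prod>k=1..<card B. bracket k p))"
      using fin False by (simp add: sum_permutations_of_set_Cons step del: rev_maj.simps)
    also have "\<dots> = p ^ num_above B a * bracket (card B) p * (\<Prod>k=1..<card B. bracket k p)"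
      by (simp only: sum_distrib_right[symmetric] sum_power_num_above_rotated[OF fin a_notin])
    also have "\<dots> = p ^ num_above B a * (\<Prod>k=1..<Suc (card B). bracket k p)"
      using False fin
      by (subst prod.atLeastLessThan_Suc) (auto simp: Suc_le_eq card_gt_0_iff algebra_simps)
    finally show ?thesis by (simp add: above_A card_A flip: B_def)
  qed
qed

theorem sum_rev_maj_permutations_of_set:
  fixes p :: "'b::comm_ring_1"
  assumes "finite A"
  shows "(\<Sum>xs\<in>permutations_of_set A. p ^ rev_maj xs) = (\<Prod>k=1..card A. bracket k p)"
proof (cases "A = {}")
  case True
  then show ?thesis by simp
next
  case False
  then have "card A \<ge> 1" using assms by (simp add: Suc_le_eq card_gt_0_iff)
  have "(\<Sum>xs\<in>permutations_of_set A. p ^ rev_maj xs) =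
        (\<Sum>a\<in>A. p ^ num_above A a * (\<Prod>k=1..<card A. bracket k p))"
    using assms False by (simp add: sum_permutations_of_set_Cons sum_rev_maj_Cons)
  also have "\<dots> = bracket (card A) p * (\<Prod>k=1..<card A. bracket k p)"
    by (simp only: sum_distrib_right[symmetric] sum_power_num_above[OF assms])
  also have "\<dots> = (\<Prod>k=1..card A. bracket k p)"
    using \<open>card A \<ge> 1\<close> by (simp add: prod.last_plus)
  finally show ?thesis .
qed

section \<open>Colored words as arrangements of letters\<close>

lemma rev_maj_map_upt:
  "rev_maj (map w (rev [1..<Suc n])) = (\<Sum>i | 1 \<le> i \<and> i \<le> n - 1 \<and> w (i + 1) < w i. i)"
proof (induction n)
  case 0
  then show ?case by simp
next
  case (Suc n)
  show ?case
  proof (cases n)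
    case 0
    then have "{i. 1 \<le> i \<and> i \<le> Suc n - 1 \<and> w (i + 1) < w i} = {}" by auto
    with 0 show ?thesis by simp
  next
    case (Suc m)
    define D where "D n = {i. 1 \<le> i \<and> i \<le> n - 1 \<and> w (i + 1) < w i}" for n
    have D_Suc: "D (Suc n) = (if w (Suc n) < w n then insert n (D n) else D n)"
      using Suc by (auto simp: D_def le_Suc_eq)
    have "n \<notin> D n" "finite (D n)" using Suc by (auto simp: D_def)
    then have "\<Sum> (D (Suc n)) = (if w (Suc n) < w n then n else 0) + \<Sum> (D n)"
      unfolding D_Suc by simp
    moreover have "rev_maj (map w (rev [1..<Suc (Suc n)])) =
        (if w (Suc n) < w n then n else 0) + rev_maj (map w (rev [1..<Suc n]))"
      using Suc by simp
    ultimately show ?thesis using Suc.IH unfolding D_def by (simp only:)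
  qed
qed

lemma bij_betw_permutes_permutations_of_set:
  "bij_betw (\<lambda>\<sigma>. map \<sigma> (rev [1..<Suc n])) {\<sigma>. \<sigma> permutes {1..n}} (permutations_of_set {1..n})"
proof -
  let ?F = "\<lambda>\<sigma>. map \<sigma> (rev [1..<Suc n])" and ?S = "{\<sigma>. \<sigma> permutes {1..n}}"
  have set_upt: "set (rev [1..<Suc n]) = {1..n}" by auto
  have inj: "inj_on ?F ?S"
  proof (rule inj_onI)
    fix \<sigma> \<tau> assume *: "\<sigma> \<in> ?S" "\<tau> \<in> ?S" "?F \<sigma> = ?F \<tau>"
    then have "\<sigma> i = \<tau> i" if "i \<in> {1..n}" for i
      using that set_upt by (metis map_eq_conv)
    then show "\<sigma> = \<tau>" using *(1,2) by (metis ext mem_Collect_eq permutes_not_in)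
  qed
  have "?F ` ?S \<subseteq> permutations_of_set {1..n}"
  proof clarify
    fix \<sigma> assume s: "\<sigma> permutes {1..n}"
    show "?F \<sigma> \<in> permutations_of_set {1..n}"
    proof (rule permutations_of_setI)
      show "set (?F \<sigma>) = {1..n}"
        unfolding set_map set_upt by (rule permutes_image[OF s])
      show "distinct (?F \<sigma>)"
        unfolding distinct_map using permutes_inj_on[OF s] by simp
    qed
  qed
  moreover have "card (?F ` ?S) = card (permutations_of_set {1..n})"
    using card_permutations[of "{1..n}" n] by (simp only: card_image[OF inj]) simp
  ultimately have "?F ` ?S = permutations_of_set {1..n}"
    by (intro card_subset_eq) auto
  with inj show ?thesis by (simp add: bij_betw_def)
qed

text \<open>
  The color is negated because a larger color makes a letter smaller. The lexicographic order on
  these pairs is then the order on colored letters.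
\<close>

definition letter_key :: "(nat \<Rightarrow> nat) \<Rightarrow> nat \<Rightarrow> int \<times> nat" where
  "letter_key c j = (- int (c j), j)"

lemma maj_color_by_value:
  assumes "\<sigma> permutes {1..n}"
  shows "maj n (\<sigma>, restrict (c \<circ> \<sigma>) {1..n}) =
         rev_maj (map (letter_key c) (map \<sigma> (rev [1..<Suc n])))"
proof -
  have "{i. 1 \<le> i \<and> i \<le> n - 1 \<and>
            letter_less (letter (\<sigma>, restrict (c \<circ> \<sigma>) {1..n}) (i + 1))
                        (letter (\<sigma>, restrict (c \<circ> \<sigma>) {1..n}) i)} =
        {i. 1 \<le> i \<and> i \<le> n - 1 \<and> (letter_key c \<circ> \<sigma>) (i + 1) < (letter_key c \<circ> \<sigma>) i}"
    by (auto simp: letter_less_def letter_def letter_key_def)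
  then show ?thesis
    unfolding maj_def using rev_maj_map_upt[of "letter_key c \<circ> \<sigma>" n] by simp
qed

text \<open>
  Once the colors are attached to the values, the major index has the same distribution for every
  choice of colors: by MacMahon's theorem it depends only on the number of letters.
\<close>

lemma sum_maj_fixed_colors:
  fixes p :: "'b::comm_ring_1"
  shows "(\<Sum>\<sigma> | \<sigma> permutes {1..n}. p ^ maj n (\<sigma>, restrict (c \<circ> \<sigma>) {1..n})) =
         (\<Prod>k=1..n. bracket k p)"
proof -
  have inj: "inj_on (letter_key c) {1..n}"
    by (auto simp: inj_on_def letter_key_def)
  have "(\<Sum>\<sigma> | \<sigma> permutes {1..n}. p ^ maj n (\<sigma>, restrict (c \<circ> \<sigma>) {1..n})) =
        (\<Sum>\<sigma> | \<sigma> permutes {1..n}.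
           (\<lambda>xs. p ^ rev_maj (map (letter_key c) xs)) (map \<sigma> (rev [1..<Suc n])))"
    by (intro sum.cong refl) (simp only: mem_Collect_eq maj_color_by_value)
  also have "\<dots> = (\<Sum>xs\<in>permutations_of_set {1..n}. p ^ rev_maj (map (letter_key c) xs))"
    by (rule sum.reindex_bij_betw[OF bij_betw_permutes_permutations_of_set])
  also have "\<dots> = (\<Sum>xs\<in>map (letter_key c) ` permutations_of_set {1..n}. p ^ rev_maj xs)"
  proof (rule sum.reindex_cong[symmetric, OF _ refl refl])
    show "inj_on (map (letter_key c)) (permutations_of_set {1..n})"
      by (rule inj_onI) (metis inj map_inj_on permutations_of_setD(1) Un_absorb)
  qed
  also have "\<dots> = (\<Prod>k=1..n. bracket k p)"
    using sum_rev_maj_permutations_of_set[of "letter_key c ` {1..n}" p]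
    by (simp only: permutations_of_set_image_inj[OF inj] card_image[OF inj] finite_imageI
        finite_atLeastAtMost card_atLeastAtMost diff_Suc_1)
  finally show ?thesis .
qed

lemma bij_betw_color_by_value:
  assumes "\<sigma> permutes I"
  shows "bij_betw (\<lambda>c. restrict (c \<circ> \<sigma>) I) (I \<rightarrow>\<^sub>E C) (I \<rightarrow>\<^sub>E C)"
proof (rule bij_betw_byWitness[where f' = "\<lambda>z. restrict (z \<circ> inv \<sigma>) I"])
  note in_I = permutes_in_image[OF assms] permutes_in_image[OF permutes_inv[OF assms]]
  show "\<forall>c\<in>I \<rightarrow>\<^sub>E C. restrict (restrict (c \<circ> \<sigma>) I \<circ> inv \<sigma>) I = c"
  proof
    fix c assume c: "c \<in> I \<rightarrow>\<^sub>E C"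
    have "restrict (restrict (c \<circ> \<sigma>) I \<circ> inv \<sigma>) I = restrict c I"
      by (rule restrict_ext) (simp add: in_I permutes_inverses[OF assms])
    then show "restrict (restrict (c \<circ> \<sigma>) I \<circ> inv \<sigma>) I = c"
      using PiE_restrict[OF c] by simp
  qed
  show "\<forall>z\<in>I \<rightarrow>\<^sub>E C. restrict (restrict (z \<circ> inv \<sigma>) I \<circ> \<sigma>) I = z"
  proof
    fix z assume z: "z \<in> I \<rightarrow>\<^sub>E C"
    have "restrict (restrict (z \<circ> inv \<sigma>) I \<circ> \<sigma>) I = restrict z I"
      by (rule restrict_ext) (simp add: in_I permutes_inverses[OF assms])
    then show "restrict (restrict (z \<circ> inv \<sigma>) I \<circ> \<sigma>) I = z"
      using PiE_restrict[OF z] by simp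
  qed
  show "(\<lambda>c. restrict (c \<circ> \<sigma>) I) ` (I \<rightarrow>\<^sub>E C) \<subseteq> I \<rightarrow>\<^sub>E C"
    by (auto simp: in_I)
  show "(\<lambda>z. restrict (z \<circ> inv \<sigma>) I) ` (I \<rightarrow>\<^sub>E C) \<subseteq> I \<rightarrow>\<^sub>E C"
    by (auto simp: in_I)
qed

lemma weight_color_by_value:
  fixes t q :: "'a::comm_ring_1" and c :: "nat \<Rightarrow> nat"
  assumes "\<sigma> permutes {1..n}"
  defines "\<pi> \<equiv> (\<sigma>, restrict (c \<circ> \<sigma>) {1..n})"
  shows "t ^ rmaj n \<pi> * q ^ fmaj r n \<pi> =
         (t * q ^ r) ^ maj n \<pi> * (\<Prod>j=1..n. (t ^ j * q) ^ c j)"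
proof -
  have by_value: "(\<Sum>i=1..n. g (\<sigma> i)) = (\<Sum>j=1..n. g j)" for g :: "nat \<Rightarrow> nat"
    by (rule sum.reindex_bij_betw[OF permutes_imp_bij[OF assms(1)]])
  have "rmaj n \<pi> = maj n \<pi> + (\<Sum>j=1..n. c j * j)"
    using by_value[of "\<lambda>j. c j * j"] by (simp add: rmaj_def \<pi>_def)
  moreover have "fmaj r n \<pi> = r * maj n \<pi> + (\<Sum>j=1..n. c j)"
    using by_value[of c] by (simp add: fmaj_def \<pi>_def)
  moreover have "(\<Prod>j=1..n. (t ^ j * q) ^ c j) = t ^ (\<Sum>j=1..n. c j * j) * q ^ (\<Sum>j=1..n. c j)"
    by (simp add: power_sum power_mult_distrib prod.distrib power_mult[symmetric] mult.commute)
  ultimately show ?thesis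
    by (simp add: power_add power_mult_distrib power_mult algebra_simps)
qed

section \<open>The joint distribution of the root and flag major indices\<close>

theorem theorem5p4:
  fixes r n :: nat and t q :: "'a::comm_ring_1"
  assumes "r \<ge> 1" and "n \<ge> 1"
  shows "(\<Sum>\<pi>\<in>colored_perms r n. t ^ rmaj n \<pi> * q ^ fmaj r n \<pi>) =
         (\<Prod>k=1..n. bracket r (t ^ k * q) * bracket k (t * q ^ r))"
proof -
  let ?S = "{\<sigma>. \<sigma> permutes {1..n}}" and ?C = "{1..n} \<rightarrow>\<^sub>E {0..<r}"
  let ?w = "\<lambda>\<sigma> c. (\<sigma>, restrict (c \<circ> \<sigma>) {1..n})"
  let ?wt = "\<lambda>\<pi>. t ^ rmaj n \<pi> * q ^ fmaj r n \<pi>"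
  have "(\<Sum>\<pi>\<in>colored_perms r n. ?wt \<pi>) = (\<Sum>\<sigma>\<in>?S. \<Sum>z\<in>?C. ?wt (\<sigma>, z))"
    unfolding colored_perms_def by (simp add: sum.cartesian_product)
  also have "\<dots> = (\<Sum>\<sigma>\<in>?S. \<Sum>c\<in>?C. ?wt (?w \<sigma> c))"
  proof (rule sum.cong[OF refl])
    fix \<sigma> assume "\<sigma> \<in> ?S"
    then have "\<sigma> permutes {1..n}" by simp
    from sum.reindex_bij_betw[OF bij_betw_color_by_value[OF this], of "\<lambda>z. ?wt (\<sigma>, z)" "{0..<r}"]
    show "(\<Sum>z\<in>?C. ?wt (\<sigma>, z)) = (\<Sum>c\<in>?C. ?wt (?w \<sigma> c))" by simp
  qed
  also have "\<dots> = (\<Sum>\<sigma>\<in>?S. \<Sum>c\<in>?C.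
      (t * q ^ r) ^ maj n (?w \<sigma> c) * (\<Prod>j=1..n. (t ^ j * q) ^ c j))"
    by (intro sum.cong refl weight_color_by_value) simp
  also have "\<dots> = (\<Sum>c\<in>?C. \<Sum>\<sigma>\<in>?S.
      (t * q ^ r) ^ maj n (?w \<sigma> c) * (\<Prod>j=1..n. (t ^ j * q) ^ c j))"
    by (rule sum.swap)
  also have "\<dots> = (\<Sum>c\<in>?C. (\<Prod>k=1..n. bracket k (t * q ^ r)) * (\<Prod>j=1..n. (t ^ j * q) ^ c j))"
    by (simp only: sum_distrib_right[symmetric] sum_maj_fixed_colors)
  also have "\<dots> = (\<Prod>k=1..n. bracket k (t * q ^ r)) * (\<Sum>c\<in>?C. \<Prod>j=1..n. (t ^ j * q) ^ c j)"
    by (rule sum_distrib_left[symmetric])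
  also have "(\<Sum>c\<in>?C. \<Prod>j=1..n. (t ^ j * q) ^ c j) = (\<Prod>j=1..n. bracket r (t ^ j * q))"
    unfolding bracket_def lessThan_atLeast0 by (rule prod_sum_PiE[symmetric]) auto
  finally show ?thesis
    by (simp add: prod.distrib mult.commute)
qed

end
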